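(* For every positive integer $n\equiv0\pmod{12}$, there are at least $\frac n{24}+2$ pairwise non-isomorphic tight graphs on $n$ vertices, and for every positive integer $n\equiv6\pmod{12}$ there is at least one tight graph on $n$ vertices.
   Context: Graphs are finite and simple. A graph $G$ on $n$ vertices is tight if $G$ is $\frac n2$-regular, $G$ contains a triangle, and every edge of $G$ lies in either $0$ or exactly $\frac n6$ triangles. *)

theory Defs
  imports Complex_Main "Graph_Theory.Graph_Theory"
begin

text \<open>
  A finite simple graph is a \<^locale>\<open>pair_graph\<close>: a finite vertex set with a symmetric irreflexive
  arc relation. An undirected edge is the pair of opposite arcs \<open>(u, v)\<close> and \<open>(v, u)\<close>, so the
  degree of a vertex is its out-degree, and a statement about all edges \<open>{u, v}\<close> can be
  made about all arcs provided that it is symmetric in the two ends.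
\<close>

definition regular_of_degree :: "'a pair_pre_digraph \<Rightarrow> real \<Rightarrow> bool" where
  "regular_of_degree G d \<longleftrightarrow> (\<forall>v \<in> pverts G. real (out_degree (with_proj G) v) = d)"

definition triangles :: "'a pair_pre_digraph \<Rightarrow> 'a set set" where
  "triangles G =
     {T. T \<subseteq> pverts G \<and> card T = 3 \<and> (\<forall>u \<in> T. \<forall>v \<in> T. u \<noteq> v \<longrightarrow> (u, v) \<in> parcs G)}"

definition triangles_through :: "'a pair_pre_digraph \<Rightarrow> 'a \<Rightarrow> 'a \<Rightarrow> 'a set set" where
  "triangles_through G u v = {T \<in> triangles G. u \<in> T \<and> v \<in> T}"

text \<open>The fractions below are taken in the reals, so no rounding takes place for any order \<open>n\<close>.\<close>

definition tight :: "'a pair_pre_digraph \<Rightarrow> bool" where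
  "tight G \<longleftrightarrow>
     pair_graph G \<and>
     (let n = real (card (pverts G)) in
        regular_of_degree G (n / 2) \<and>
        triangles G \<noteq> {} \<and>
        (\<forall>(u, v) \<in> parcs G.
           card (triangles_through G u v) = 0 \<or> real (card (triangles_through G u v)) = n / 6))"

text \<open>
  For graphs of the form \<open>with_proj G\<close> an arc is determined by its ends, so
  \<^const>\<open>digraph_iso\<close> is the usual graph isomorphism: a bijection of the vertices that
  preserves adjacency in both directions.
\<close>

definition pairwise_non_isomorphic :: "'a pair_pre_digraph set \<Rightarrow> bool" where
  "pairwise_non_isomorphic \<G> \<longleftrightarrow>
     pairwise (\<lambda>G H. \<not> digraph_iso (with_proj G) (with_proj H)) \<G>"

end

theory Submission
  imports Defs
begin

text \<open>
  All graphs are weighted blow-ups of small graphs: a vertex of weight \<open>w\<close> becomes an independent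
  set of size \<open>w\<close> and an edge a complete bipartite graph, so tightness is a condition on weighted
  degrees and codegrees. Three small graphs are used: the triangular prism (weights \<open>n/6\<close>), the
  icosahedron with its antipodal matching (weights \<open>n/12\<close>), and a graph on 15 vertices whose
  admissible weights form a segment. The last graph has nine cells \<open>(i, j)\<close> with \<open>i, j < 3\<close> of
  weight \<open>s + t\<close>, three vertices of weight \<open>s\<close> and three of weight \<open>t\<close>, with \<open>s + t = n/12\<close>; cells in
  different rows and columns are adjacent, a vertex of weight \<open>s\<close> is attached to the cells outside
  one row and a vertex of weight \<open>t\<close> to the cells outside one column. For \<open>t = 0\<close> or \<open>s = 0\<close> this is
  a blow-up of the tensor product of \<open>K\<^sub>3\<close> and \<open>K\<^sub>4\<close>.

  The sizes of the classes of twins (vertices with the same neighbours) distinguish the members of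
  the segment up to exchanging \<open>s\<close> and \<open>t\<close>, and the prism from the icosahedron; these two, unlike
  the segment, have edges that lie in no triangle. This gives \<open>\<lfloor>n/24\<rfloor> + 1\<close> plus two graphs.
\<close>

section \<open>Degrees and triangles as counts of neighbours and common neighbours\<close>

definition adj :: "'a pair_pre_digraph \<Rightarrow> 'a \<Rightarrow> 'a \<Rightarrow> bool" where
  "adj G u v \<longleftrightarrow> (u, v) \<in> parcs G"

lemma out_degree_eq_card_adj:
  assumes "pair_graph G"
  shows "out_degree (with_proj G) v = card {x \<in> pverts G. adj G v x}"
proof -
  interpret pair_graph G by fact
  have "out_arcs (with_proj G) v = Pair v ` {x \<in> pverts G. adj G v x}"
    by (auto simp: out_arcs_def adj_def dest: in_arcsD2)
  then show ?thesis
    by (simp add: out_degree_def card_image inj_on_def)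
qed

text \<open>The map sending \<open>x\<close> to \<open>{u, v, x}\<close> is a bijection from the
  common neighbours of \<open>u\<close> and \<open>v\<close> to the triangles through them.\<close>

lemma card_triangles_through:
  assumes "pair_graph G" "adj G u v"
  shows "card (triangles_through G u v) = card {x \<in> pverts G. adj G u x \<and> adj G v x}"
proof -
  interpret pair_graph G by fact
  have sym: "adj G y x" if "adj G x y" for x y
    using that pair_sym_arcs by (auto simp: adj_def symmetric_def dest: symD)
  have irr: "\<not> adj G x x" for x
    using no_loops' by (auto simp: adj_def)
  have uv: "u \<noteq> v" "u \<in> pverts G" "v \<in> pverts G"
    using assms(2) irr by (auto simp: adj_def dest: in_arcsD1 in_arcsD2)
  let ?X = "{x \<in> pverts G. adj G u x \<and> adj G v x}"
  have "triangles_through G u v = (\<lambda>x. {u, v, x}) ` ?X"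
  proof (intro equalityI subsetI)
    fix T assume T: "T \<in> triangles_through G u v"
    then have T': "T \<subseteq> pverts G" "card T = 3" "u \<in> T" "v \<in> T"
      "\<And>x y. x \<in> T \<Longrightarrow> y \<in> T \<Longrightarrow> x \<noteq> y \<Longrightarrow> adj G x y"
      by (auto simp: triangles_through_def triangles_def adj_def)
    have fin: "finite T"
      using T'(2) card.infinite by fastforce
    have "card (T - {u, v}) = 1"
      using T' uv fin by (simp add: card_Diff_subset)
    then obtain x where x: "T - {u, v} = {x}"
      by (auto simp: card_1_singleton_iff)
    then have "T = {u, v, x}" "x \<noteq> u" "x \<noteq> v"
      using T' by auto
    moreover have "x \<in> ?X"
      using T' calculation by auto
    ultimately show "T \<in> (\<lambda>x. {u, v, x}) ` ?X"
      by blast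
  next
    fix T assume "T \<in> (\<lambda>x. {u, v, x}) ` ?X"
    then obtain x where x: "x \<in> pverts G" "adj G u x" "adj G v x" "T = {u, v, x}"
      by auto
    then have "x \<noteq> u" "x \<noteq> v"
      using irr by auto
    then show "T \<in> triangles_through G u v"
      using x uv assms(2) sym
      by (auto simp: triangles_through_def triangles_def adj_def)
  qed
  moreover have "inj_on (\<lambda>x. {u, v, x}) ?X"
  proof (rule inj_onI)
    fix x y assume xy: "x \<in> ?X" "y \<in> ?X" "{u, v, x} = {u, v, y}"
    then have "x \<in> {u, v, y}" "x \<noteq> u" "x \<noteq> v"
      using irr by auto
    then show "x = y"
      by simp
  qed
  ultimately show ?thesis
    by (simp add: card_image)
qed

section \<open>Isomorphism invariants\<close>

text \<open>Multiplicities are dropped: the set of sizes already separates the graphs for which it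
  is used.\<close>

definition twin_class_sizes :: "'a pair_pre_digraph \<Rightarrow> nat set" where
  "twin_class_sizes G =
     (\<lambda>v. card {u \<in> pverts G. \<forall>x \<in> pverts G. adj G u x \<longleftrightarrow> adj G v x}) ` pverts G"

definition has_triangle_free_edge :: "'a pair_pre_digraph \<Rightarrow> bool" where
  "has_triangle_free_edge G \<longleftrightarrow> (\<exists>u \<in> pverts G. \<exists>v \<in> pverts G. adj G u v \<and>
     (\<forall>x \<in> pverts G. \<not> (adj G u x \<and> adj G v x)))"

text \<open>Both graphs have \<open>fst\<close> and \<open>snd\<close> as tail and head, so the arc
  map of the isomorphism is forced by its vertex map. That adjacency is also reflected follows from
  injectivity on the vertices.\<close>

lemma digraph_iso_adjE:
  assumes "digraph_iso (with_proj G) (with_proj H)"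
  obtains f where "bij_betw f (pverts G) (pverts H)"
    and "\<And>u v. u \<in> pverts G \<Longrightarrow> v \<in> pverts G \<Longrightarrow> adj H (f u) (f v) \<longleftrightarrow> adj G u v"
proof -
  obtain h where h: "pre_digraph.digraph_isomorphism (with_proj G) h"
    "with_proj H = app_iso h (with_proj G)"
    using assms by (auto simp: digraph_iso_def)
  let ?f = "iso_verts h"
  note h1 = h(1)[unfolded pre_digraph.digraph_isomorphism_def]
  have wf: "pair_wf_digraph G"
    using h1 by (simp add: wf_digraph_wp_iff)
  have inj: "inj_on ?f (pverts G)"
    using h1 by simp
  have V: "pverts H = ?f ` pverts G" and A: "parcs H = iso_arcs h ` parcs G"
    and tl: "iso_tail h = fst" and hd: "iso_head h = snd"
    using h(2)[symmetric] by (auto simp: app_iso_def with_proj_def)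
  have arc: "iso_arcs h (u, v) = (?f u, ?f v)" if "(u, v) \<in> parcs G" for u v
    using h1 that tl hd by (auto simp: prod_eq_iff)
  show thesis
  proof
    show "bij_betw ?f (pverts G) (pverts H)"
      using inj V by (simp add: bij_betw_def)
    fix u v assume uv: "u \<in> pverts G" "v \<in> pverts G"
    show "adj H (?f u) (?f v) \<longleftrightarrow> adj G u v"
    proof
      assume "adj H (?f u) (?f v)"
      then obtain a b where ab: "(a, b) \<in> parcs G" "(?f u, ?f v) = (?f a, ?f b)"
        by (auto simp: adj_def A arc image_iff)
      then have "a \<in> pverts G" "b \<in> pverts G"
        using wf by (auto simp: pair_wf_digraph_def)
      then show "adj G u v"
        using ab uv inj by (auto simp: adj_def dest: inj_onD)
    next
      assume "adj G u v"
      then show "adj H (?f u) (?f v)"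
        using arc by (force simp: adj_def A)
    qed
  qed
qed

lemma digraph_iso_invariants:
  assumes "digraph_iso (with_proj G) (with_proj H)"
  shows "twin_class_sizes G = twin_class_sizes H"
    and "has_triangle_free_edge G = has_triangle_free_edge H"
proof -
  obtain f where f: "bij_betw f (pverts G) (pverts H)"
    and adj: "\<And>u v. u \<in> pverts G \<Longrightarrow> v \<in> pverts G \<Longrightarrow> adj H (f u) (f v) \<longleftrightarrow> adj G u v"
    using digraph_iso_adjE[OF assms] by blast
  have inj: "inj_on f (pverts G)" and V: "pverts H = f ` pverts G"
    using f by (auto simp: bij_betw_def)
  have "card {u \<in> pverts H. \<forall>x \<in> pverts H. adj H u x \<longleftrightarrow> adj H (f v) x} =
        card {u \<in> pverts G. \<forall>x \<in> pverts G. adj G u x \<longleftrightarrow> adj G v x}"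
    if v: "v \<in> pverts G" for v
  proof -
    have "{u \<in> pverts H. \<forall>x \<in> pverts H. adj H u x \<longleftrightarrow> adj H (f v) x} =
          f ` {u \<in> pverts G. \<forall>x \<in> pverts G. adj G u x \<longleftrightarrow> adj G v x}"
      using v adj by (auto simp: V)
    then show ?thesis
      using inj by (auto intro!: card_image elim: inj_on_subset)
  qed
  then show "twin_class_sizes G = twin_class_sizes H"
    unfolding twin_class_sizes_def V by (auto simp: image_image)
  show "has_triangle_free_edge G = has_triangle_free_edge H"
    using adj by (auto simp: has_triangle_free_edge_def V)
qed

section \<open>Weighted graphs and their blow-ups\<close>

text \<open>Weight 0 is allowed, so that a single relation \<open>E\<close> serves the whole segment
  including its ends.\<close>

locale weighted_graph =
  fixes C :: "'c set" and w :: "'c \<Rightarrow> nat" and E :: "'c \<Rightarrow> 'c \<Rightarrow> bool"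
  assumes finite_C: "finite C"
    and E_sym: "E i j \<Longrightarrow> E j i"
    and E_irrefl: "\<not> E i i"
begin

definition deg :: "'c \<Rightarrow> nat" where
  "deg i = (\<Sum>j \<in> C. if E i j then w j else 0)"

definition codeg :: "'c \<Rightarrow> 'c \<Rightarrow> nat" where
  "codeg i j = (\<Sum>l \<in> C. if E i l \<and> E j l then w l else 0)"

end

text \<open>The blow-up is described by its projection \<open>c\<close> and the sizes of the fibres.
  This leaves the vertex type free; later all blow-ups live on natural numbers and can be collected
  in one set.\<close>

locale blow_up = weighted_graph C w E
  for C :: "'c set" and w E +
  fixes V :: "'a set" and c :: "'a \<Rightarrow> 'c"
  assumes finite_V: "finite V"
    and c_in: "x \<in> V \<Longrightarrow> c x \<in> C"
    and card_fibre: "i \<in> C \<Longrightarrow> card {x \<in> V. c x = i} = w i"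
begin

definition graph :: "'a pair_pre_digraph" where
  "graph = \<lparr>pverts = V, parcs = {(u, v). u \<in> V \<and> v \<in> V \<and> E (c u) (c v)}\<rparr>"

lemma pverts_graph [simp]: "pverts graph = V"
  by (simp add: graph_def)

lemma adj_graph: "adj graph u v \<longleftrightarrow> u \<in> V \<and> v \<in> V \<and> E (c u) (c v)"
  by (simp add: graph_def adj_def)

lemma pair_graph_graph: "pair_graph graph"
proof unfold_locales
  have "parcs graph \<subseteq> V \<times> V"
    by (auto simp: graph_def)
  then show "finite (parcs graph)"
    by (rule finite_subset) (simp add: finite_V)
  show "symmetric (with_proj graph)"
    by (auto simp: symmetric_def graph_def intro!: symI E_sym)
qed (auto simp: graph_def finite_V E_irrefl)

text \<open>The fibres of \<open>c\<close> partition \<open>V\<close>. Order, degrees and codegrees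
  are all counts of this kind.\<close>

lemma card_classes: "card {x \<in> V. P (c x)} = (\<Sum>i \<in> C. if P i then w i else 0)"
proof -
  have "{x \<in> V. P (c x)} = (\<Union>i \<in> {i \<in> C. P i}. {x \<in> V. c x = i})"
    using c_in by auto
  also have "card \<dots> = (\<Sum>i \<in> {i \<in> C. P i}. card {x \<in> V. c x = i})"
    using finite_C finite_V by (intro card_UN_disjoint) auto
  also have "\<dots> = (\<Sum>i \<in> {i \<in> C. P i}. w i)"
    by (intro sum.cong) (auto simp: card_fibre)
  also have "\<dots> = (\<Sum>i \<in> C. if P i then w i else 0)"
    using finite_C by (simp add: sum.inter_filter)
  finally show ?thesis .
qed

lemma ex_class: "i \<in> C \<Longrightarrow> w i > 0 \<Longrightarrow> \<exists>x \<in> V. c x = i"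
  using card_fibre[of i] by (metis (mono_tags, lifting) card_gt_0_iff empty_Collect_eq)

lemma weight_pos:
  assumes "x \<in> V"
  shows "w (c x) > 0"
proof -
  have "{y \<in> V. c y = c x} \<noteq> {}"
    using assms by auto
  then have "card {y \<in> V. c y = c x} > 0"
    using finite_V by (simp add: card_gt_0_iff)
  then show ?thesis
    using card_fibre c_in assms by simp
qed

lemma image_classes: "c ` V = {i \<in> C. w i > 0}"
proof
  show "c ` V \<subseteq> {i \<in> C. w i > 0}"
    using c_in weight_pos by auto
  show "{i \<in> C. w i > 0} \<subseteq> c ` V"
    using ex_class by auto
qed

lemma card_V: "card V = sum w C"
  using card_classes[of "\<lambda>_. True"] by simp

lemma card_triangles_through_graph:
  assumes "adj graph u v"
  shows "card (triangles_through graph u v) = codeg (c u) (c v)"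
proof -
  have "u \<in> V" "v \<in> V"
    using assms by (auto simp: adj_graph)
  then show ?thesis
    using card_triangles_through[OF pair_graph_graph assms]
      card_classes[of "\<lambda>l. E (c u) l \<and> E (c v) l"]
    by (simp add: adj_graph codeg_def cong: conj_cong)
qed

text \<open>For order \<open>6 * m\<close> the values n/2 and n/6 are \<open>3 * m\<close> and
  \<open>m\<close>. An edge between nonempty cells with positive codegree supplies a
  triangle.\<close>

lemma tight_graph:
  assumes total: "sum w C = 6 * m" and m: "m > 0"
    and degree: "\<forall>i \<in> C. deg i = 3 * m"
    and books: "\<forall>i \<in> C. \<forall>j \<in> C. E i j \<longrightarrow> codeg i j \<in> {0, m}"
    and triangle: "\<exists>i \<in> C. \<exists>j \<in> C. w i > 0 \<and> w j > 0 \<and> E i j \<and> codeg i j = m"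
  shows "tight graph"
proof -
  have n: "card (pverts graph) = 6 * m"
    by (simp add: card_V total)
  have "out_degree (with_proj graph) v = 3 * m" if "v \<in> V" for v
    using that out_degree_eq_card_adj[OF pair_graph_graph, of v]
      card_classes[of "E (c v)"] degree c_in[of v]
    by (simp add: adj_graph deg_def cong: conj_cong)
  then have "regular_of_degree graph (real (card (pverts graph)) / 2)"
    using n by (simp add: regular_of_degree_def)
  moreover have "triangles graph \<noteq> {}"
  proof -
    obtain i j where ij: "i \<in> C" "j \<in> C" "w i > 0" "w j > 0" "E i j" "codeg i j = m"
      using triangle by blast
    then obtain u v where uv: "u \<in> V" "c u = i" "v \<in> V" "c v = j"
      using ex_class by blast
    then have "card (triangles_through graph u v) = m"
      using card_triangles_through_graph[of u v] ij by (simp add: adj_graph)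
    then have "triangles_through graph u v \<noteq> {}"
      using m by auto
    then show ?thesis
      by (auto simp: triangles_through_def)
  qed
  moreover have "card (triangles_through graph u v) \<in> {0, m}" if "(u, v) \<in> parcs graph" for u v
  proof -
    have uv: "adj graph u v"
      using that by (simp add: adj_def)
    then show ?thesis
      using card_triangles_through_graph[OF uv] books c_in
      by (simp add: adj_graph)
  qed
  ultimately show ?thesis
    using pair_graph_graph n by (fastforce simp: tight_def)
qed

text \<open>Vertices in one cell are always twins. The hypothesis separates any two nonempty cells
  by a third nonempty cell, so the twin classes are exactly the nonempty cells; removing 0 discards
  the empty ones.\<close>

lemma twin_class_sizes_graph:
  assumes "\<forall>i \<in> C. \<forall>j \<in> C. w i > 0 \<longrightarrow> w j > 0 \<longrightarrow> i \<noteq> j \<longrightarrow>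
      (\<exists>l \<in> C. w l > 0 \<and> E i l \<noteq> E j l)"
  shows "twin_class_sizes graph = w ` C - {0}"
proof -
  have "card {u \<in> V. \<forall>x \<in> V. adj graph u x \<longleftrightarrow> adj graph v x} = w (c v)" if v: "v \<in> V" for v
  proof -
    have "c u = c v" if u: "u \<in> V" and eq: "\<forall>x \<in> V. adj graph u x \<longleftrightarrow> adj graph v x" for u
    proof (rule ccontr)
      assume "c u \<noteq> c v"
      then obtain l where l: "l \<in> C" "w l > 0" "E (c u) l \<noteq> E (c v) l"
        using assms c_in[OF u] c_in[OF v] weight_pos[OF u] weight_pos[OF v] by blast
      then obtain x where "x \<in> V" "c x = l"
        using ex_class by blast
      then have "adj graph u x \<noteq> adj graph v x"
        using l u v by (simp add: adj_graph)
      then show False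
        using eq \<open>x \<in> V\<close> by blast
    qed
    then have "{u \<in> V. \<forall>x \<in> V. adj graph u x \<longleftrightarrow> adj graph v x} \<subseteq> {u \<in> V. c u = c v}"
      by blast
    moreover have "{u \<in> V. c u = c v} \<subseteq> {u \<in> V. \<forall>x \<in> V. adj graph u x \<longleftrightarrow> adj graph v x}"
    proof (intro Collect_mono impI, elim conjE, intro conjI)
      fix u assume "u \<in> V" "c u = c v"
      then show "\<forall>x \<in> V. adj graph u x \<longleftrightarrow> adj graph v x"
        using v by (simp add: adj_graph)
    qed
    ultimately have "{u \<in> V. \<forall>x \<in> V. adj graph u x \<longleftrightarrow> adj graph v x} = {u \<in> V. c u = c v}"
      by (rule equalityI)
    then show ?thesis
      using card_fibre c_in v by simp
  qed
  then have "twin_class_sizes graph = (\<lambda>v. w (c v)) ` V"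
    by (simp add: twin_class_sizes_def)
  also have "\<dots> = w ` c ` V"
    by (simp add: image_image)
  also have "\<dots> = w ` C - {0}"
    by (auto simp: image_classes)
  finally show ?thesis .
qed

lemma has_triangle_free_edge_graph:
  "has_triangle_free_edge graph \<longleftrightarrow>
    (\<exists>i \<in> C. \<exists>j \<in> C. w i > 0 \<and> w j > 0 \<and> E i j \<and> codeg i j = 0)"
proof -
  \<comment> \<open>Read backwards, \<open>card_classes\<close> turns the weighted sum into the
    number of common neighbours in \<open>V\<close>.\<close>
  have codeg_0: "codeg i j = 0 \<longleftrightarrow> (\<forall>x \<in> V. \<not> (E i (c x) \<and> E j (c x)))" for i j
    using card_classes[of "\<lambda>l. E i l \<and> E j l", symmetric] finite_V by (auto simp: codeg_def)
  have "has_triangle_free_edge graph \<longleftrightarrow> (\<exists>i \<in> c ` V. \<exists>j \<in> c ` V. E i j \<and>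
      (\<forall>x \<in> V. \<not> (E i (c x) \<and> E j (c x))))"
    by (auto simp: has_triangle_free_edge_def adj_graph)
  then show ?thesis
    unfolding codeg_0 image_classes by blast
qed

end

context weighted_graph
begin

text \<open>The pairs of some \<open>i\<close> in \<open>C\<close> and an index below
  \<open>w i\<close> are numbered by an initial segment of the naturals.\<close>

lemma ex_blow_up: "\<exists>(V :: nat set) c. blow_up C w E V c"
proof -
  let ?S = "SIGMA i:C. {..<w i}"
  have fin: "finite ?S"
    using finite_C by simp
  obtain h where h: "bij_betw h {0..<card ?S} ?S"
    using ex_bij_betw_nat_finite[OF fin] by blast
  have "card {x \<in> {0..<card ?S}. fst (h x) = i} = w i" if "i \<in> C" for i
  proof -
    have "h ` {x \<in> {0..<card ?S}. fst (h x) = i} = {y \<in> h ` {0..<card ?S}. fst y = i}"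
      by auto
    also have "\<dots> = {y \<in> ?S. fst y = i}"
      using h by (simp add: bij_betw_def)
    also have "\<dots> = Pair i ` {..<w i}"
      using that by auto
    finally have "card (h ` {x \<in> {0..<card ?S}. fst (h x) = i}) = w i"
      by (simp add: card_image inj_on_def)
    moreover have "inj_on h {x \<in> {0..<card ?S}. fst (h x) = i}"
      using h by (auto simp: bij_betw_def elim: inj_on_subset)
    ultimately show ?thesis
      by (simp add: card_image)
  qed
  moreover have "fst (h x) \<in> C" if "x \<in> {0..<card ?S}" for x
  proof -
    have "h x \<in> ?S"
      using bij_betwE[OF h] that by blast
    then show ?thesis
      by auto
  qed
  ultimately have "blow_up C w E {0..<card ?S} (fst \<circ> h)"
    by unfold_locales auto
  then show ?thesis
    by blast
qed

lemma ex_tight_blow_up: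
  assumes total: "sum w C = 6 * m" and m: "m > 0"
    and degree: "\<forall>i \<in> C. deg i = 3 * m"
    and books: "\<forall>i \<in> C. \<forall>j \<in> C. E i j \<longrightarrow> codeg i j \<in> {0, m}"
    and triangle: "\<exists>i \<in> C. \<exists>j \<in> C. w i > 0 \<and> w j > 0 \<and> E i j \<and> codeg i j = m"
    and twin_free: "\<forall>i \<in> C. \<forall>j \<in> C. w i > 0 \<longrightarrow> w j > 0 \<longrightarrow> i \<noteq> j \<longrightarrow>
      (\<exists>l \<in> C. w l > 0 \<and> E i l \<noteq> E j l)"
  obtains G :: "nat pair_pre_digraph" where "tight G" "card (pverts G) = 6 * m"
    "twin_class_sizes G = w ` C - {0}"
    "has_triangle_free_edge G \<longleftrightarrow>
      (\<exists>i \<in> C. \<exists>j \<in> C. w i > 0 \<and> w j > 0 \<and> E i j \<and> codeg i j = 0)"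
proof -
  obtain V :: "nat set" and c where "blow_up C w E V c"
    using ex_blow_up by blast
  then interpret blow_up C w E V c .
  show ?thesis
  proof
    show "tight graph"
      by (rule tight_graph) (fact assms)+
    show "twin_class_sizes graph = w ` C - {0}"
      by (rule twin_class_sizes_graph) (fact twin_free)
  qed (simp_all only: has_triangle_free_edge_graph pverts_graph card_V total)
qed

end

section \<open>Conditions on list graphs that can be evaluated\<close>

text \<open>
  These conditions on a graph given by a list of vertices are stated for a concrete weight, so that
  they can be evaluated; they are preserved by the combination \<open>s * \<alpha> i + t * \<beta> i\<close> of two weights.
\<close>

definition balanced :: "nat \<Rightarrow> 'c list \<Rightarrow> ('c \<Rightarrow> 'c \<Rightarrow> bool) \<Rightarrow> ('c \<Rightarrow> nat) \<Rightarrow> bool" where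
  "balanced \<mu> L E \<alpha> \<longleftrightarrow>
     sum_list (map \<alpha> L) = 6 * \<mu> \<and>
     (\<forall>i \<in> set L. sum_list (map \<alpha> (filter (E i) L)) = 3 * \<mu>) \<and>
     (\<forall>i \<in> set L. \<forall>j \<in> set L. E i j \<longrightarrow> (\<exists>l \<in> set L. E i l \<and> E j l) \<longrightarrow>
        sum_list (map \<alpha> (filter (\<lambda>l. E i l \<and> E j l) L)) = \<mu>)"

definition separated :: "'c list \<Rightarrow> ('c \<Rightarrow> 'c \<Rightarrow> bool) \<Rightarrow> ('c \<Rightarrow> bool) \<Rightarrow> bool" where
  "separated L E P \<longleftrightarrow> (\<forall>i \<in> set L. \<forall>j \<in> set L. i \<noteq> j \<longrightarrow> (\<exists>l \<in> set L. P l \<and> E i l \<noteq> E j l))"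

definition triangle_in :: "'c list \<Rightarrow> ('c \<Rightarrow> 'c \<Rightarrow> bool) \<Rightarrow> ('c \<Rightarrow> bool) \<Rightarrow> bool" where
  "triangle_in L E P \<longleftrightarrow>
     (\<exists>i \<in> set L. \<exists>j \<in> set L. \<exists>l \<in> set L. P i \<and> P j \<and> E i j \<and> E i l \<and> E j l)"

definition triangle_free_edge_in :: "'c list \<Rightarrow> ('c \<Rightarrow> 'c \<Rightarrow> bool) \<Rightarrow> ('c \<Rightarrow> bool) \<Rightarrow> bool" where
  "triangle_free_edge_in L E P \<longleftrightarrow>
     (\<exists>i \<in> set L. \<exists>j \<in> set L. P i \<and> P j \<and> E i j \<and> \<not> (\<exists>l \<in> set L. E i l \<and> E j l))"

lemma sum_if_eq_sum_list:
  fixes \<alpha> \<beta> :: "'c \<Rightarrow> nat"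
  assumes "distinct L"
  shows "(\<Sum>l \<in> set L. if P l then s * \<alpha> l + t * \<beta> l else 0) =
    s * sum_list (map \<alpha> (filter P L)) + t * sum_list (map \<beta> (filter P L))"
  using assms by (induction L) (auto simp: algebra_simps)

text \<open>Order, degrees and codegrees are linear in the weight. In \<open>balanced\<close> the
  graph alone decides which codegrees vanish, so \<open>\<alpha>\<close> and \<open>\<beta>\<close>
  cannot disagree on this and a combined codegree is 0 or \<open>\<mu> * (s + t)\<close>. Vertices
  where both weights are positive stay nonempty for all admissible \<open>s\<close> and
  \<open>t\<close>, so they serve as witnesses.\<close>

lemma ex_tight_list_blow_up:
  fixes L :: "'c list" and \<alpha> \<beta> w :: "'c \<Rightarrow> nat"
  assumes w: "w = (\<lambda>i. s * \<alpha> i + t * \<beta> i)"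
    and "distinct L"
    and E_sym: "\<And>i j. E i j \<Longrightarrow> E j i" and E_irrefl: "\<And>i. \<not> E i i"
    and pos: "\<mu> * (s + t) > 0"
    and bal: "balanced \<mu> L E \<alpha>" "balanced \<mu> L E \<beta>"
    and sep: "separated L E (\<lambda>i. \<alpha> i > 0 \<and> \<beta> i > 0)"
    and tri: "triangle_in L E (\<lambda>i. \<alpha> i > 0 \<and> \<beta> i > 0)"
  obtains G :: "nat pair_pre_digraph" where "tight G" "card (pverts G) = 6 * (\<mu> * (s + t))"
    "twin_class_sizes G = w ` set L - {0}"
    "has_triangle_free_edge G \<longleftrightarrow> triangle_free_edge_in L E (\<lambda>i. w i > 0)"
proof -
  interpret weighted_graph "set L" w E
    by unfold_locales (use E_sym E_irrefl in auto)
  note sums = sum_if_eq_sum_list[OF \<open>distinct L\<close>]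
  let ?m = "\<mu> * (s + t)"
  have w_pos: "w i > 0" if "\<alpha> i > 0 \<and> \<beta> i > 0" for i
    using that pos by (auto simp: w)
  have total: "sum w (set L) = 6 * ?m"
    using sums[of "\<lambda>_. True" s \<alpha> t \<beta>] bal by (simp add: w balanced_def algebra_simps)
  have degree: "\<forall>i \<in> set L. deg i = 3 * ?m"
    unfolding deg_def unfolding w sums using bal by (simp add: balanced_def algebra_simps)
  have codeg: "codeg i j = (if \<exists>l \<in> set L. E i l \<and> E j l then ?m else 0)"
    if "i \<in> set L" "j \<in> set L" "E i j" for i j
  proof (cases "\<exists>l \<in> set L. E i l \<and> E j l")
    case True
    then show ?thesis
      unfolding codeg_def unfolding w sums using bal that by (simp add: balanced_def algebra_simps)
  qed (auto simp: codeg_def)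
  have books: "\<forall>i \<in> set L. \<forall>j \<in> set L. E i j \<longrightarrow> codeg i j \<in> {0, ?m}"
    by (simp add: codeg)
  have twin_free: "\<forall>i \<in> set L. \<forall>j \<in> set L. w i > 0 \<longrightarrow> w j > 0 \<longrightarrow> i \<noteq> j \<longrightarrow>
      (\<exists>l \<in> set L. w l > 0 \<and> E i l \<noteq> E j l)"
    using sep w_pos unfolding separated_def by blast
  obtain a b l where "a \<in> set L" "b \<in> set L" "l \<in> set L" "w a > 0" "w b > 0"
      "E a b" "E a l" "E b l"
    using tri w_pos unfolding triangle_in_def by blast
  \<comment> \<open>The vertex \<open>l\<close> only certifies that the codegree of \<open>a\<close>
    and \<open>b\<close> is nonzero; its own weight may be 0.\<close>
  then have triangle: "\<exists>i \<in> set L. \<exists>j \<in> set L. w i > 0 \<and> w j > 0 \<and> E i j \<and> codeg i j = ?m"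
    by (intro bexI[of _ a] bexI[of _ b]) (auto simp: codeg)
  have isolated: "(\<exists>i \<in> set L. \<exists>j \<in> set L. w i > 0 \<and> w j > 0 \<and> E i j \<and> codeg i j = 0) \<longleftrightarrow>
      triangle_free_edge_in L E (\<lambda>i. w i > 0)"
    unfolding triangle_free_edge_in_def
    by (intro bex_cong refl conj_cong) (use pos in \<open>auto simp: codeg\<close>)
  show thesis
    using ex_tight_blow_up[OF total pos degree books triangle twin_free] that
    unfolding isolated by blast
qed

lemma ex_tight_uniform_blow_up:
  fixes L :: "'c list"
  assumes "distinct L" "L \<noteq> []" "\<And>i j. E i j \<Longrightarrow> E j i" "\<And>i. \<not> E i i" "\<mu> > 0" "k > 0"
    and "balanced \<mu> L E (\<lambda>_. 1)"
    and "separated L E (\<lambda>_. True)"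
    and "triangle_in L E (\<lambda>_. True)"
    and "triangle_free_edge_in L E (\<lambda>_. True)"
  shows "\<exists>G :: nat pair_pre_digraph. tight G \<and> card (pverts G) = 6 * (\<mu> * k) \<and>
    twin_class_sizes G = {k} \<and> has_triangle_free_edge G"
proof -
  \<comment> \<open>The constant weight \<open>k\<close> is written as a combination with
    \<open>s = k\<close> and \<open>t = 0\<close> of two copies of the weight 1.\<close>
  define w :: "'c \<Rightarrow> nat" where "w = (\<lambda>i. k * 1 + 0 * 1)"
  have pos: "\<mu> * (k + 0) > 0"
    using assms by simp
  have sep: "separated L E (\<lambda>_. (0::nat) < 1 \<and> (0::nat) < 1)"
    and tri: "triangle_in L E (\<lambda>_. (0::nat) < 1 \<and> (0::nat) < 1)"
    using assms by simp_all
  obtain G :: "nat pair_pre_digraph" where "tight G" "card (pverts G) = 6 * (\<mu> * (k + 0))"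
    "twin_class_sizes G = w ` set L - {0}"
    "has_triangle_free_edge G \<longleftrightarrow> triangle_free_edge_in L E (\<lambda>i. w i > 0)"
    by (rule ex_tight_list_blow_up[OF w_def assms(1,3,4) pos assms(7,7) sep tri])
  moreover have "w ` set L - {0} = {k}"
    using assms(2,6) by (auto simp: w_def image_constant_conv)
  ultimately show ?thesis
    using assms(6,10) by (intro exI[of _ G]) (simp add: w_def)
qed

section \<open>The three base graphs\<close>

definition prism_verts :: "(nat \<times> nat) list" where
  "prism_verts = List.product [0, 1] [0, 1, 2]"

text \<open>Exactly one coordinate agrees: the first along the two triangles, the second along the
  three rungs, which lie in no triangle.\<close>

definition prism_adj :: "nat \<times> nat \<Rightarrow> nat \<times> nat \<Rightarrow> bool" where
  "prism_adj = (\<lambda>(a, i) (b, j). (a = b) \<noteq> (i = j))"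

lemma prism_verts_props:
  "distinct prism_verts" "prism_verts \<noteq> []"
  "balanced 1 prism_verts prism_adj (\<lambda>_. 1)"
  "separated prism_verts prism_adj (\<lambda>_. True)"
  "triangle_in prism_verts prism_adj (\<lambda>_. True)"
  "triangle_free_edge_in prism_verts prism_adj (\<lambda>_. True)"
  by code_simp+

lemma exists_tight_prism:
  assumes "m > 0"
  shows "\<exists>G :: nat pair_pre_digraph. tight G \<and> card (pverts G) = 6 * m \<and>
    twin_class_sizes G = {m} \<and> has_triangle_free_edge G"
  using ex_tight_uniform_blow_up[OF prism_verts_props(1,2) _ _ _ assms prism_verts_props(3-)]
  by (auto simp: prism_adj_def)

definition icosahedron_verts :: "(nat \<times> bool) list" where
  "icosahedron_verts = List.product [0, 1, 2, 3, 4, 5] [False, True]"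

text \<open>
  The antipodal pairs are \<open>{(i, False), (i, True)}\<close>; the poles have \<open>i = 5\<close>, and the pole \<open>(5, a)\<close> is
  joined to the pentagon \<open>(0, a), \<dots>, (4, a)\<close>.
\<close>

definition icosahedron_adj :: "nat \<times> bool \<Rightarrow> nat \<times> bool \<Rightarrow> bool" where
  "icosahedron_adj = (\<lambda>(i, a) (j, b). if i = j then a \<noteq> b
     else (a = b) = (i = 5 \<or> j = 5 \<or> i = Suc j \<or> j = Suc i \<or> i + j = 4 \<and> (i = 0 \<or> j = 0)))"

text \<open>For \<open>a \<noteq> b\<close>, distinct non-polar indices are joined when they are not
  consecutive on the pentagon. Antipodal vertices have no common neighbour, so the added matching
  leaves each icosahedron edge in 2 triangles and its own edges in none; the degree is 5 + 1 = 3 *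
  2.\<close>

lemma icosahedron_verts_props:
  "distinct icosahedron_verts" "icosahedron_verts \<noteq> []"
  "balanced 2 icosahedron_verts icosahedron_adj (\<lambda>_. 1)"
  "separated icosahedron_verts icosahedron_adj (\<lambda>_. True)"
  "triangle_in icosahedron_verts icosahedron_adj (\<lambda>_. True)"
  "triangle_free_edge_in icosahedron_verts icosahedron_adj (\<lambda>_. True)"
  by code_simp+

lemma exists_tight_icosahedron:
  assumes "k > 0"
  shows "\<exists>G :: nat pair_pre_digraph. tight G \<and> card (pverts G) = 12 * k \<and>
    twin_class_sizes G = {k} \<and> has_triangle_free_edge G"
proof -
  have "icosahedron_adj i j \<Longrightarrow> icosahedron_adj j i" "\<not> icosahedron_adj i i" for i j
    by (auto simp: icosahedron_adj_def split: if_splits)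
  then show ?thesis
    using ex_tight_uniform_blow_up[OF icosahedron_verts_props(1,2) _ _ _ assms
        icosahedron_verts_props(3-)] by simp
qed

text \<open>
  The index 3 marks the vertices that are not cells: \<open>(3, j)\<close> is adjacent to the cells outside
  column \<open>j\<close>, and \<open>(i, 3)\<close> to the cells outside row \<open>i\<close>.
\<close>

definition grid_verts :: "(nat \<times> nat) list" where
  "grid_verts = removeAll (3, 3) (List.product [0, 1, 2, 3] [0, 1, 2, 3])"

definition grid_adj :: "nat \<times> nat \<Rightarrow> nat \<times> nat \<Rightarrow> bool" where
  "grid_adj = (\<lambda>(i, j) (i', j'). i \<noteq> i' \<and> j \<noteq> j' \<and> \<not> ((i = 3 \<or> i' = 3) \<and> (j = 3 \<or> j' = 3)))"

text \<open>This is one end of the segment: \<open>grid_adj\<close> on the 12 vertices of weight 1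
  is the tensor product of a triangle and a complete graph on four vertices.\<close>

definition row_weight :: "nat \<times> nat \<Rightarrow> nat" where
  "row_weight = (\<lambda>(i, j). if i = 3 then 0 else 1)"

definition column_weight :: "nat \<times> nat \<Rightarrow> nat" where
  "column_weight = (\<lambda>(i, j). if j = 3 then 0 else 1)"

text \<open>\<open>balanced\<close> also tests the vertices of weight 0, since they become nonempty
  once the two weights are combined.\<close>

lemma grid_verts_props:
  "distinct grid_verts"
  "balanced 2 grid_verts grid_adj row_weight"
  "balanced 2 grid_verts grid_adj column_weight"
  "separated grid_verts grid_adj (\<lambda>i. row_weight i > 0 \<and> column_weight i > 0)"
  "triangle_in grid_verts grid_adj (\<lambda>i. row_weight i > 0 \<and> column_weight i > 0)"
  "\<not> triangle_free_edge_in grid_verts grid_adj (\<lambda>_. True)"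
  by code_simp+

lemma exists_tight_grid:
  assumes "s + t > 0"
  shows "\<exists>G :: nat pair_pre_digraph. tight G \<and> card (pverts G) = 12 * (s + t) \<and>
    twin_class_sizes G = {s, t, s + t} - {0} \<and> \<not> has_triangle_free_edge G"
proof -
  define w where "w = (\<lambda>i. s * row_weight i + t * column_weight i)"
  obtain G :: "nat pair_pre_digraph" where "tight G" "card (pverts G) = 6 * (2 * (s + t))"
    "twin_class_sizes G = w ` set grid_verts - {0}"
    "has_triangle_free_edge G \<longleftrightarrow> triangle_free_edge_in grid_verts grid_adj (\<lambda>i. w i > 0)"
  proof (rule ex_tight_list_blow_up[OF w_def grid_verts_props(1) _ _ _ grid_verts_props(2-5)])
    show "2 * (s + t) > 0"
      using assms by simp
  qed (auto simp: grid_adj_def)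
  moreover have "w ` set grid_verts = {s, t, s + t}"
    by (auto simp: w_def grid_verts_def row_weight_def column_weight_def)
  moreover have "\<not> triangle_free_edge_in grid_verts grid_adj (\<lambda>i. w i > 0)"
    using grid_verts_props(6) unfolding triangle_free_edge_in_def by blast
  ultimately show ?thesis
    by (intro exI[of _ G]) simp
qed

section \<open>Counting non-isomorphic graphs\<close>

text \<open>Choosing one graph for each pair of invariants reduces the count of graphs to a count of
  realised pairs.\<close>

lemma ex_non_isomorphic_family:
  fixes I :: "(nat set \<times> bool) set"
  assumes "finite I"
    and "\<And>x. x \<in> I \<Longrightarrow> \<exists>G :: nat pair_pre_digraph. tight G \<and> card (pverts G) = n \<and>
      (twin_class_sizes G, has_triangle_free_edge G) = x"
  obtains \<G> :: "nat pair_pre_digraph set" where "finite \<G>"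
    "\<forall>G \<in> \<G>. tight G \<and> card (pverts G) = n" "pairwise_non_isomorphic \<G>" "card \<G> = card I"
proof -
  obtain g :: "nat set \<times> bool \<Rightarrow> nat pair_pre_digraph" where
    g: "\<And>x. x \<in> I \<Longrightarrow> tight (g x) \<and> card (pverts (g x)) = n"
    and inv: "\<And>x. x \<in> I \<Longrightarrow> (twin_class_sizes (g x), has_triangle_free_edge (g x)) = x"
    using assms(2) by metis
  show thesis
  proof
    show "finite (g ` I)"
      using assms(1) by simp
    show "\<forall>G \<in> g ` I. tight G \<and> card (pverts G) = n"
      using g by blast
    show "pairwise_non_isomorphic (g ` I)"
      unfolding pairwise_non_isomorphic_def pairwise_def
    proof (intro ballI impI notI)
      fix G H assume "G \<in> g ` I" "H \<in> g ` I" "G \<noteq> H"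
        and iso: "digraph_iso (with_proj G) (with_proj H)"
      then obtain x y where xy: "x \<in> I" "y \<in> I" "G = g x" "H = g y"
        by blast
      have "(twin_class_sizes G, has_triangle_free_edge G) = (twin_class_sizes H, has_triangle_free_edge H)"
        using digraph_iso_invariants[OF iso] by simp
      then have "x = y"
        using inv[OF xy(1)] inv[OF xy(2)] unfolding xy(3,4) by (metis (no_types))
      then show False
        using \<open>G \<noteq> H\<close> xy by simp
    qed
    have "inj_on g I"
    proof (rule inj_onI)
      fix x y assume xy: "x \<in> I" "y \<in> I" "g x = g y"
      show "x = y"
        using inv[OF xy(1)] inv[OF xy(2)] unfolding xy(3) by (rule trans[OF sym])
    qed
    then show "card (g ` I) = card I"
      by (rule card_image)
  qed
qed

text \<open>The bound \<open>k div 2\<close> removes the symmetry between \<open>t\<close> and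
  \<open>k - t\<close>. For \<open>t < u\<close> a nonzero \<open>t\<close> is smaller than
  \<open>u\<close>, \<open>k - u\<close> and \<open>k\<close>, hence missing from the second set;
  for \<open>t = 0\<close> the first set is \<open>{k}\<close>, which misses
  \<open>u\<close>.\<close>

lemma inj_on_grid_class_sizes:
  fixes k :: nat
  shows "inj_on (\<lambda>t. {k - t, t, k} - {0}) {..k div 2}"
proof -
  have "{k - t, t, k} - {0} \<noteq> {k - u, u, k} - {0}" if "t < u" "u \<le> k div 2" for t u
  proof (cases "t = 0")
    case True
    then have "u \<in> {k - u, u, k} - {0}" "u \<notin> {k - t, t, k} - {0}"
      using that by auto
    then show ?thesis
      by blast
  next
    case False
    then have "t \<in> {k - t, t, k} - {0}" "t \<notin> {k - u, u, k} - {0}"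
      using that by auto
    then show ?thesis
      by blast
  qed
  then show ?thesis
    by (metis (no_types, lifting) atMost_iff inj_onI linorder_neqE_nat)
qed

lemma ex_tight_family:
  assumes "k > 0"
  obtains \<G> :: "nat pair_pre_digraph set" where "finite \<G>"
    "\<forall>G \<in> \<G>. tight G \<and> card (pverts G) = 12 * k" "pairwise_non_isomorphic \<G>"
    "card \<G> = k div 2 + 3"
proof -
  define A where "A = (\<lambda>t. ({k - t, t, k} - {0}, False)) ` {..k div 2}"
  \<comment> \<open>The icosahedron has classes of size n/12 = \<open>k\<close>, the prism of size
    n/6 = \<open>2 * k\<close>. The flag is essential: at \<open>t = 0\<close> the segment also has
    \<open>k\<close> as its only class size.\<close>
  define B where "B = {({k}, True), ({2 * k}, True)}"
  have "inj_on (\<lambda>t. ({k - t, t, k} - {0}, False)) {..k div 2}"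
    using inj_on_grid_class_sizes[of k] unfolding inj_on_def by (simp only: prod.inject simp_thms)
  then have "card A = k div 2 + 1"
    by (simp add: A_def card_image)
  moreover have "card B = 2"
    using assms by (simp add: B_def)
  moreover have "A \<inter> B = {}"
    by (auto simp: A_def B_def)
  moreover have fin: "finite A" "finite B"
    by (simp_all add: A_def B_def)
  ultimately have card: "card (A \<union> B) = k div 2 + 3"
    by (simp add: card_Un_disjoint)
  have realised: "\<exists>G :: nat pair_pre_digraph. tight G \<and> card (pverts G) = 12 * k \<and>
      (twin_class_sizes G, has_triangle_free_edge G) = x" if "x \<in> A \<union> B" for x
  proof -
    have "(\<exists>t \<in> {..k div 2}. x = ({k - t, t, k} - {0}, False)) \<or> x = ({k}, True) \<or> x = ({2 * k}, True)"
      using that unfolding A_def B_def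
      by (simp only: Un_iff image_iff insert_iff empty_iff simp_thms)
    then consider (segment) t where "t \<le> k div 2" "x = ({k - t, t, k} - {0}, False)"
      | (icosahedron) "x = ({k}, True)" | (prism) "x = ({2 * k}, True)"
      unfolding Bex_def atMost_iff by blast
    then show ?thesis
    proof cases
      case segment
      then have "k - t + t = k"
        by simp
      then obtain G :: "nat pair_pre_digraph" where "tight G" "card (pverts G) = 12 * k"
        "twin_class_sizes G = {k - t, t, k} - {0}" "\<not> has_triangle_free_edge G"
        using exists_tight_grid[of "k - t" t] assms by auto
      then show ?thesis
        unfolding segment(2) by blast
    next
      case icosahedron
      then show ?thesis
        using exists_tight_icosahedron[OF assms] by blast
    next
      case prism
      have "6 * (2 * k) = 12 * k" "2 * k > 0"
        using assms by simp_all
      then show ?thesis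
        using exists_tight_prism[of "2 * k"] unfolding prism by metis
    qed
  qed
  show thesis
    by (rule ex_non_isomorphic_family[OF finite_UnI[OF fin] realised]) (auto intro: that simp: card)
qed

theorem proposition3p12:
  fixes n :: nat
  assumes "n > 0"
  shows "(n mod 12 = 0 \<longrightarrow>
            (\<exists>\<G> :: nat pair_pre_digraph set.
               finite \<G> \<and>
               (\<forall>G \<in> \<G>. tight G \<and> card (pverts G) = n) \<and>
               pairwise_non_isomorphic \<G> \<and>
               real (card \<G>) \<ge> real n / 24 + 2)) \<and>
         (n mod 12 = 6 \<longrightarrow>
            (\<exists>G :: nat pair_pre_digraph. tight G \<and> card (pverts G) = n))"
proof (intro conjI impI)
  assume "n mod 12 = 0"
  then obtain k where k: "n = 12 * k"
    by auto
  then obtain \<G> :: "nat pair_pre_digraph set" where "finite \<G>"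
    "\<forall>G \<in> \<G>. tight G \<and> card (pverts G) = n" "pairwise_non_isomorphic \<G>"
    and card: "card \<G> = k div 2 + 3"
    using ex_tight_family[of k] assms by auto
  moreover have "real n / 24 + 2 \<le> real (card \<G>)"
  proof -
    \<comment> \<open>Rounding k/2 down loses at most 1/2, so \<open>k div 2 + 3\<close> is at least
      k/2 + 2 = n/24 + 2.\<close>
    have "k \<le> 2 * (k div 2 + 1)"
      by simp
    then have "real k \<le> real (2 * (k div 2 + 1))"
      by (simp only: of_nat_le_iff)
    then show ?thesis
      by (simp add: k card)
  qed
  ultimately show "\<exists>\<G> :: nat pair_pre_digraph set. finite \<G> \<and>
      (\<forall>G \<in> \<G>. tight G \<and> card (pverts G) = n) \<and> pairwise_non_isomorphic \<G> \<and>
      real n / 24 + 2 \<le> real (card \<G>)"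
    by blast
next
  assume "n mod 12 = 6"
  then have "6 * (n div 6) = n"
    by presburger
  then show "\<exists>G :: nat pair_pre_digraph. tight G \<and> card (pverts G) = n"
    using exists_tight_prism[of "n div 6"] assms by (metis mult_0_right neq0_conv)
qed
end
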